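(* If $f(z)=z+\sum_{n=2}^{\infty}a_nz^n\in \mathcal{S}_{S,L}^*$, then $$|H_{2,1}(F_{f^{-1}}/2)|=|\Gamma_1\Gamma_3-\Gamma_2^2|\leq\frac{1}{64}.$$ The inequality is sharp.
   Context: $\mathbb{D}=\{z\in\mathbb{C}:|z|<1\}$. $\mathcal{S}$ is the class of univalent (injective) analytic functions $f$ on $\mathbb{D}$ with expansion $f(z)=z+\sum_{n\ge 2}a_nz^n$. For analytic $g,h$ on $\mathbb{D}$, $g\prec h$ (subordination) means $g=h\circ w$ for some analytic $w:\mathbb{D}\to\mathbb{D}$ with $w(0)=0$. The class is $$\mathcal{S}_{S,L}^*=\left\{f\in\mathcal{S}:\ \frac{2zf'(z)}{f(z)-f(-z)}\prec \sqrt{1+z}\right\}$$ (principal branch of the square root). For $f\in\mathcal{S}$, let $F(w)=f^{-1}(w)=w+A_2w^2+A_3w^3+\cdots$ be the inverse function near $0$ (defined for $|w|<1/4$). The logarithmic inverse coefficients $\Gamma_n$ are defined by $\log\big(F(w)/w\big)=2\sum_{n\ge1}\Gamma_nw^n$, $|w|<1/4$ (branch with $\log 1=0$), and $H_{2,1}(F_{f^{-1}}/2):=\Gamma_1\Gamma_3-\Gamma_2^2$. "Sharp" means that equality is attained by some function in the class. *)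

theory Defs
  imports "HOL-Complex_Analysis.Complex_Analysis"
begin

text \<open>
  Functions on the unit disc are total functions \<open>complex \<Rightarrow> complex\<close> of which only the
  restriction to \<open>ball 0 1\<close> is ever used.
\<close>

definition schlicht :: "(complex \<Rightarrow> complex) set" where
  "schlicht = {f. f holomorphic_on ball 0 1 \<and> inj_on f (ball 0 1) \<and>
     (\<exists>a :: nat \<Rightarrow> complex. \<forall>z\<in>ball 0 1. (\<lambda>n. a (n + 2) * z ^ (n + 2)) sums (f z - z))}"

definition subordinate :: "(complex \<Rightarrow> complex) \<Rightarrow> (complex \<Rightarrow> complex) \<Rightarrow> bool"
    (infix "\<prec>\<^sub>s" 50) where
  "g \<prec>\<^sub>s h \<longleftrightarrow> g holomorphic_on ball 0 1 \<and> h holomorphic_on ball 0 1 \<and>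
     (\<exists>w. w holomorphic_on ball 0 1 \<and> w ` ball 0 1 \<subseteq> ball 0 1 \<and> w 0 = 0 \<and>
          (\<forall>z\<in>ball 0 1. g z = h (w z)))"

text \<open>
  The quotient \<open>2 z f'(z) / (f z - f (- z))\<close> has a removable singularity at the origin, with
  value \<open>f' 0 / f' 0 = 1\<close>. The value must be given explicitly since \<open>0 / 0 = 0\<close> in HOL.
  Elsewhere in the disc the denominator is nonzero by injectivity.
\<close>
definition sym_quotient :: "(complex \<Rightarrow> complex) \<Rightarrow> complex \<Rightarrow> complex" where
  "sym_quotient f z = (if z = 0 then 1 else 2 * z * deriv f z / (f z - f (- z)))"

definition S_SL :: "(complex \<Rightarrow> complex) set" where
  "S_SL = {f \<in> schlicht. sym_quotient f \<prec>\<^sub>s (\<lambda>z. csqrt (1 + z))}"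

definition inverse_fun :: "(complex \<Rightarrow> complex) \<Rightarrow> complex \<Rightarrow> complex" where
  "inverse_fun f = inv_into (ball 0 1) f"

text \<open>
  \<open>log (F w / w)\<close> with its removable singularity at the origin filled in. Near the origin
  \<open>F w / w\<close> is close to 1, so the principal logarithm is the analytic branch with \<open>log 1 = 0\<close>
  there, and the germ at the origin determines the coefficients.
\<close>
definition log_inverse :: "(complex \<Rightarrow> complex) \<Rightarrow> complex \<Rightarrow> complex" where
  "log_inverse f w = (if w = 0 then 0 else Ln (inverse_fun f w / w))"

definition log_inverse_coeff :: "(complex \<Rightarrow> complex) \<Rightarrow> nat \<Rightarrow> complex" where
  "log_inverse_coeff f n = fps_nth (fps_expansion (log_inverse f) 0) n / 2"

text \<open>The second Hankel determinant \<open>H\<^sub>2\<^sub>,\<^sub>1\<close> of the logarithmic inverse coefficients.\<close>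
definition hankel_log_inverse :: "(complex \<Rightarrow> complex) \<Rightarrow> complex" where
  "hankel_log_inverse f =
     log_inverse_coeff f 1 * log_inverse_coeff f 3 - (log_inverse_coeff f 2)\<^sup>2"

lemma schlicht_at_0:
  assumes "f \<in> schlicht"
  shows "f 0 = 0" "deriv f 0 = 1"
proof -
  from assms obtain a :: "nat \<Rightarrow> complex"
    where a: "\<And>z. z \<in> ball 0 1 \<Longrightarrow> (\<lambda>n. a (n + 2) * z ^ (n + 2)) sums (f z - z)"
    unfolding schlicht_def by blast
  define b where "b n = (if n = 0 then 0 else if n = 1 then 1 else a n)" for n
  have b: "(\<lambda>n. b n * z ^ n) sums f z" if "z \<in> ball 0 1" for z
  proof -
    have "(\<lambda>n. b (n + 2) * z ^ (n + 2)) sums (f z - (\<Sum>i<2. b i * z ^ i))"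
      using a[OF that] by (simp add: b_def eval_nat_numeral)
    thus ?thesis by (subst (asm) sums_iff_shift) simp
  qed
  show "f 0 = 0" using b[of 0] sums_unique2[OF powser_sums_zero[of b] b[of 0]]
    by (simp add: b_def)
  have "(f has_field_derivative deriv f 0) (at 0)"
    using assms holomorphic_derivI[OF _ open_ball, of f 0 1 0] by (simp add: schlicht_def)
  hence "(\<lambda>n. diffs b n * 0 ^ n) sums deriv f 0"
    by (intro termdiffs_sums_strong[where K = 1 and f = f]) (use b in auto)
  from sums_unique2[OF this powser_sums_zero[of "diffs b"]]
  show "deriv f 0 = 1" by (simp add: diffs_def b_def)
qed

text \<open>The defining expansion \<open>log (F w / w) = 2 (\<Gamma>\<^sub>1 w + \<Gamma>\<^sub>2 w\<^sup>2 + \<dots>)\<close>.\<close>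
lemma log_inverse_expansion:
  assumes "f \<in> schlicht"
  shows "\<exists>r>0. log_inverse f holomorphic_on ball 0 r \<and>
           (\<forall>w\<in>ball 0 r. f (inverse_fun f w) = w \<and>
              (w \<noteq> 0 \<longrightarrow> exp (log_inverse f w) = inverse_fun f w / w) \<and>
              (\<lambda>n. 2 * log_inverse_coeff f (Suc n) * w ^ Suc n) sums log_inverse f w)"
proof -
  note f0 = schlicht_at_0[OF assms]
  have hol: "f holomorphic_on ball 0 1" and inj: "inj_on f (ball 0 1)"
    using assms unfolding schlicht_def by auto
  define F where "F = inverse_fun f"
  have Fl: "F (f z) = z" if "z \<in> ball 0 1" for z
    using inv_into_f_f[OF inj that] by (simp add: F_def inverse_fun_def)
  obtain g where g: "g holomorphic_on (f ` ball 0 1)"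
      "\<And>z. z \<in> ball 0 1 \<Longrightarrow> deriv f z * deriv g (f z) = 1"
      "\<And>z. z \<in> ball 0 1 \<Longrightarrow> g (f z) = z"
    using holomorphic_has_inverse[OF hol open_ball inj] by metis
  let ?V = "f ` ball 0 1"
  have op: "open ?V" using open_mapping_thm3[OF hol open_ball inj] .
  have V0: "0 \<in> ?V" using f0(1) by (metis centre_in_ball imageI zero_less_one)
  have Fg: "F w = g w" if "w \<in> ?V" for w using that Fl g(3) by auto
  have F0: "g 0 = 0" using g(3)[of 0] f0 by simp
  have g0: "deriv g 0 = 1" using g(2)[of 0] f0 by simp
  define q where "q w = (if w = 0 then deriv g 0 else (g w - g 0) / (w - 0))" for w
  have q: "q holomorphic_on ?V"
    unfolding q_def by (rule pole_lemma_open[OF g(1) op])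
  have q0: "q 0 = 1" by (simp add: q_def g0)
  have "isCont q 0" using q op V0
    by (meson continuous_on_eq_continuous_at holomorphic_on_imp_continuous_on)
  hence "((\<lambda>w. Re (q w)) \<longlongrightarrow> Re (q 0)) (nhds 0)"
    by (intro tendsto_Re) (simp add: continuous_at tendsto_at_iff_tendsto_nhds)
  hence "eventually (\<lambda>w. Re (q w) > 0) (nhds 0)"
    using q0 by (intro order_tendstoD(1)) auto
  moreover have "eventually (\<lambda>w. w \<in> ?V) (nhds 0)"
    using op V0 by (rule eventually_nhds_in_open)
  ultimately have "eventually (\<lambda>w. Re (q w) > 0 \<and> w \<in> ?V) (nhds 0)"
    by (rule eventually_conj)
  then obtain r where r: "r > 0" "\<And>w. w \<in> ball 0 r \<Longrightarrow> Re (q w) > 0 \<and> w \<in> ?V"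
    unfolding eventually_nhds_metric by (auto simp: dist_commute)
  have Lq: "log_inverse f w = Ln (q w)" if "w \<in> ball 0 r" for w
    using Fg[of w] r(2)[OF that] g0 F0 by (auto simp: log_inverse_def q_def F_def)
  have "(\<lambda>w. Ln (q w)) holomorphic_on ball 0 r"
  proof (rule holomorphic_on_Ln')
    show "q holomorphic_on ball 0 r"
      by (rule holomorphic_on_subset[OF q]) (use r in auto)
  qed (use r(2) in \<open>force simp: complex_nonpos_Reals_iff\<close>)
  hence L: "log_inverse f holomorphic_on ball 0 r"
    using Lq by (subst holomorphic_cong[OF refl Lq])
  have "f (inverse_fun f w) = w \<and>
        (w \<noteq> 0 \<longrightarrow> exp (log_inverse f w) = inverse_fun f w / w) \<and>
        (\<lambda>n. 2 * log_inverse_coeff f (Suc n) * w ^ Suc n) sums log_inverse f w"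
    if w: "w \<in> ball 0 r" for w
  proof (intro conjI impI)
    show "f (inverse_fun f w) = w"
      unfolding inverse_fun_def using r(2)[OF w] by (intro f_inv_into_f) auto
    show "exp (log_inverse f w) = inverse_fun f w / w" if "w \<noteq> 0"
    proof -
      have "q w \<noteq> 0" using r(2)[OF w] by force
      moreover have "q w = inverse_fun f w / w"
        using that r(2)[OF w] Fg[of w] F0 by (simp add: q_def F_def)
      ultimately show ?thesis using Lq[OF w] by (simp add: exp_Ln)
    qed
    have "(\<lambda>n. (deriv ^^ n) (log_inverse f) 0 / fact n * (w - 0) ^ n) sums log_inverse f w"
      by (rule holomorphic_power_series[OF L w])
    hence "(\<lambda>n. 2 * log_inverse_coeff f n * w ^ n) sums log_inverse f w"
      by (simp add: log_inverse_coeff_def fps_expansion_def)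
    moreover have "log_inverse_coeff f 0 = 0"
      by (simp add: log_inverse_coeff_def fps_expansion_def log_inverse_def)
    ultimately show "(\<lambda>n. 2 * log_inverse_coeff f (Suc n) * w ^ Suc n) sums log_inverse f w"
      by (subst sums_Suc_iff) simp
  qed
  with L r(1) show ?thesis by blast
qed

end

(* By the Schur algorithm, the coefficients c1, c2, c3 of a Schwarz function w satisfy
   c2 = (1 - |c1|^2) x and c3 = (1 - |c1|^2) (y - cnj c1 x^2) with |x| <= 1, |y| <= 1 - |x|^2.
   Comparing coefficients in 2 z f'(z) = (f z - f (-z)) sqrt (1 + w z) turns the Hankel determinant
   into a polynomial in the c's, and after inserting the above parametrisation the triangle
   inequality already gives the sharp constant.

   Equality holds for w z = z^2. Then f is odd and z f'/f = sqrt (1 + z^2) =: s, which integrates to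
   f z = 2 z exp (s - 1) / (1 + s). Its derivative 2 s exp (s - 1) / (1 + s) has positive real part,
   since s lies in the right half of the lemniscate |s^2 - 1| < 1; hence f is univalent. *)
theory Submission
  imports Defs
begin

unbundle no vec_syntax

declare csqrt.simps [simp del]

section \<open>Power series of bounded functions and the Schur algorithm\<close>

text \<open>An expansion depends only on the germ at \<open>0\<close>. Every functional identity
  below is turned into an identity of formal power series in this way.\<close>

lemma fps_eq_if_eventually_eq:
  fixes f g :: "complex \<Rightarrow> complex"
  assumes "eventually (\<lambda>z. f z = g z) (nhds 0)"
    and "f has_fps_expansion F" "g has_fps_expansion G"
  shows "F = G"
proof (rule fps_expansion_unique_complex)
  show "f has_fps_expansion G" using assms(3) has_fps_expansion_cong[OF assms(1) refl] by simp
qed (fact assms(2))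

text \<open>If \<open>norm g\<close> attains \<open>1\<close> in the disc, then \<open>g\<close> is
  constant by the maximum principle and \<open>h = 0\<close> works. Otherwise a disc automorphism
  moves \<open>g 0\<close> to \<open>0\<close>, and the Schwarz lemma allows division by
  \<open>z\<close> without losing the bound. Multiplying out the denominator gives one identity for
  both cases, ready for comparing coefficients.\<close>

lemma schur_step:
  fixes g :: "complex \<Rightarrow> complex"
  assumes hol: "g holomorphic_on ball 0 1"
    and bound: "\<And>z. norm z < 1 \<Longrightarrow> norm (g z) \<le> 1"
  obtains h where "h holomorphic_on ball 0 1"
    "\<And>z. norm z < 1 \<Longrightarrow> norm (h z) \<le> 1"
    "\<And>z. norm z < 1 \<Longrightarrow> g z - g 0 = z * h z * (1 - cnj (g 0) * g z)"
proof (cases "\<exists>\<xi>\<in>ball 0 1. norm (g \<xi>) = 1")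
  case True
  then obtain \<xi> where \<xi>: "\<xi> \<in> ball 0 1" "norm (g \<xi>) = 1" by blast
  have "g constant_on ball 0 1"
    by (rule maximum_modulus_principle[OF hol _ _ _ order_refl \<xi>(1)])
       (use bound \<xi>(2) in auto)
  then obtain c where "\<And>z. z \<in> ball 0 1 \<Longrightarrow> g z = c" unfolding constant_on_def by blast
  then have const: "g z = g 0" if "norm z < 1" for z
    using that by (metis centre_in_ball mem_ball_0 zero_less_one)
  show ?thesis
  proof (rule that[of "\<lambda>_. 0"])
    show "g z - g 0 = z * 0 * (1 - cnj (g 0) * g z)" if "norm z < 1" for z
      unfolding const[OF that] by simp
  qed simp_all
next
  case False
  then have lt: "norm (g z) < 1" if "norm z < 1" for z
  proof -
    have "norm (g z) \<noteq> 1" using False that by auto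
    then show ?thesis using bound[OF that] by linarith
  qed
  define m where "m = Moebius_function 0 (g 0) \<circ> g"
  have m: "m holomorphic_on ball 0 1"
    unfolding m_def
    by (rule holomorphic_on_compose_gen[OF hol Moebius_function_holomorphic])
       (use lt in auto)
  have m0: "m 0 = 0" by (simp add: m_def Moebius_function_eq_zero)
  have mlt: "norm (m z) < 1" if "norm z < 1" for z
    using Moebius_function_norm_lt_1[of "g 0" "g z" 0] lt that by (simp add: m_def)
  obtain h where h: "h holomorphic_on ball 0 1"
      "\<And>z. norm z < 1 \<Longrightarrow> m z = z * h z" "deriv m 0 = h 0"
    using Schwarz3[OF m m0] by blast
  show ?thesis
  proof (rule that[OF h(1)])
    fix z :: complex assume z: "norm z < 1"
    show "norm (h z) \<le> 1"
    \<comment> \<open>At the origin the bound comes from the derivative part of the Schwarz lemma,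
      since \<open>h 0 = deriv m 0\<close>.\<close>
    proof (cases "z = 0")
      case True
      then show ?thesis using Schwarz_Lemma(2)[OF m m0 mlt z] h(3) by simp
    next
      case False
      then show ?thesis
        using Schwarz_Lemma(1)[OF m m0 mlt z] h(2)[OF z] by (simp add: norm_mult)
    qed
    have "norm (cnj (g 0) * g z) < 1"
      using lt[of 0] lt[OF z] norm_mult_less[of "cnj (g 0)" 1 "g z" 1] by simp
    then have "1 - cnj (g 0) * g z \<noteq> 0" by auto
    moreover have "m z = (g z - g 0) / (1 - cnj (g 0) * g z)"
      by (simp add: m_def Moebius_function_simple)
    ultimately show "g z - g 0 = z * h z * (1 - cnj (g 0) * g z)"
      using h(2)[OF z] by (simp add: eq_divide_eq)
  qed
qed

lemma schur_step_fps:
  fixes g :: "complex \<Rightarrow> complex"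
  assumes hol: "g holomorphic_on ball 0 1"
    and bound: "\<And>z. norm z < 1 \<Longrightarrow> norm (g z) \<le> 1"
    and G: "g has_fps_expansion G"
  obtains h H where "h holomorphic_on ball 0 1"
    "\<And>z. norm z < 1 \<Longrightarrow> norm (h z) \<le> 1" "h has_fps_expansion H"
    "G - fps_const (G $ 0) = fps_X * H * (1 - fps_const (cnj (G $ 0)) * G)"
proof -
  obtain h where h: "h holomorphic_on ball 0 1"
    "\<And>z. norm z < 1 \<Longrightarrow> norm (h z) \<le> 1"
    "\<And>z. norm z < 1 \<Longrightarrow> g z - g 0 = z * h z * (1 - cnj (g 0) * g z)"
    using schur_step[OF hol bound] by blast
  define H where "H = fps_expansion h 0"
  have H: "h has_fps_expansion H"
    unfolding H_def by (rule has_fps_expansion_fps_expansion[OF open_ball _ h(1)]) simp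
  have g0: "g 0 = G $ 0" by (rule has_fps_expansion_imp_0_eq_fps_nth_0[OF G])
  have "eventually (\<lambda>z. z \<in> ball (0::complex) 1) (nhds 0)"
    by (rule eventually_nhds_in_open) auto
  then have ev: "eventually (\<lambda>z. g z - g 0 = z * h z * (1 - cnj (g 0) * g z)) (nhds 0)"
    by eventually_elim (use h(3) in auto)
  have "(\<lambda>z. g z - g 0) has_fps_expansion (G - fps_const (G $ 0))"
    unfolding g0 by (intro fps_expansion_intros G)
  moreover have "(\<lambda>z. z * h z * (1 - cnj (g 0) * g z)) has_fps_expansion
      (fps_X * H * (1 - fps_const (cnj (G $ 0)) * G))"
    unfolding g0 by (intro fps_expansion_intros G H)
  ultimately have "G - fps_const (G $ 0) = fps_X * H * (1 - fps_const (cnj (G $ 0)) * G)"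
    by (rule fps_eq_if_eventually_eq[OF ev])
  with h H that show ?thesis by blast
qed

text \<open>Two Schur steps, from \<open>g\<close> to \<open>h\<close> and from \<open>h\<close> to
  \<open>k\<close>. The witnesses are \<open>x = H $ 0\<close> and \<open>y = H $ 1\<close>; the
  second step gives \<open>H $ 1 = K $ 0 * (1 - |x|^2)\<close>, hence the bound on
  \<open>y\<close>.\<close>

lemma bounded_fps_coeffs:
  fixes g :: "complex \<Rightarrow> complex"
  assumes hol: "g holomorphic_on ball 0 1"
    and bound: "\<And>z. norm z < 1 \<Longrightarrow> norm (g z) \<le> 1"
    and G: "g has_fps_expansion G"
  obtains x y :: complex where "norm (G $ 0) \<le> 1" "norm x \<le> 1" "norm y \<le> 1 - (norm x)\<^sup>2"
    "G $ 1 = of_real (1 - (norm (G $ 0))\<^sup>2) * x"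
    "G $ 2 = of_real (1 - (norm (G $ 0))\<^sup>2) * (y - cnj (G $ 0) * x\<^sup>2)"
proof -
  obtain h H where h: "h holomorphic_on ball 0 1"
    "\<And>z. norm z < 1 \<Longrightarrow> norm (h z) \<le> 1" "h has_fps_expansion H"
    "G - fps_const (G $ 0) = fps_X * H * (1 - fps_const (cnj (G $ 0)) * G)"
    using schur_step_fps[OF assms] by blast
  obtain k K where k: "k holomorphic_on ball 0 1"
    "\<And>z. norm z < 1 \<Longrightarrow> norm (k z) \<le> 1" "k has_fps_expansion K"
    "H - fps_const (H $ 0) = fps_X * K * (1 - fps_const (cnj (H $ 0)) * H)"
    using schur_step_fps[OF h(1-3)] by blast
  have nG: "norm (G $ 0) \<le> 1"
    using bound[of 0] has_fps_expansion_imp_0_eq_fps_nth_0[OF G] by simp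
  have nH: "norm (H $ 0) \<le> 1"
    using h(2)[of 0] has_fps_expansion_imp_0_eq_fps_nth_0[OF h(3)] by simp
  have nK: "norm (K $ 0) \<le> 1"
    using k(2)[of 0] has_fps_expansion_imp_0_eq_fps_nth_0[OF k(3)] by simp
  have sq: "of_real ((norm a)\<^sup>2) = a * cnj a" for a :: complex
    by (rule complex_norm_square)
  have G1: "G $ 1 = H $ 0 * (1 - cnj (G $ 0) * G $ 0)"
    using arg_cong[OF h(4), of "\<lambda>F. F $ 1"] by (simp add: mult.assoc)
  have G2: "G $ 2 = H $ 1 * (1 - cnj (G $ 0) * G $ 0) - H $ 0 * cnj (G $ 0) * G $ 1"
    using arg_cong[OF h(4), of "\<lambda>F. F $ 2"]
    by (simp add: mult.assoc fps_mult_nth eval_nat_numeral algebra_simps)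
  have H1: "H $ 1 = K $ 0 * (1 - cnj (H $ 0) * H $ 0)"
    using arg_cong[OF k(4), of "\<lambda>F. F $ 1"] by (simp add: mult.assoc)
  show ?thesis
  proof (rule that[OF nG nH])
    have "H $ 1 = K $ 0 * of_real (1 - (norm (H $ 0))\<^sup>2)"
      unfolding of_real_diff sq H1 by simp
    then have "norm (H $ 1) = norm (K $ 0) * \<bar>1 - (norm (H $ 0))\<^sup>2\<bar>"
      by (simp only: norm_mult norm_of_real)
    also have "\<dots> = norm (K $ 0) * (1 - (norm (H $ 0))\<^sup>2)"
      using nH by (simp add: power_le_one)
    also have "\<dots> \<le> 1 - (norm (H $ 0))\<^sup>2"
      using nK nH by (intro mult_left_le_one_le) (auto simp: power_le_one)
    finally show "norm (H $ 1) \<le> 1 - (norm (H $ 0))\<^sup>2" .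
    show "G $ 1 = of_real (1 - (norm (G $ 0))\<^sup>2) * H $ 0"
      unfolding of_real_diff sq using G1 by (simp add: mult.commute)
    show "G $ 2 = of_real (1 - (norm (G $ 0))\<^sup>2) * (H $ 1 - cnj (G $ 0) * (H $ 0)\<^sup>2)"
      unfolding of_real_diff sq G2 G1 of_real_1 by (simp add: power2_eq_square algebra_simps)
  qed
qed

section \<open>Estimate of the coefficient functional\<close>

text \<open>The functional is the one obtained in \<open>hankel_of_schwarz\<close>. The triangle
  inequality leaves a real polynomial in \<open>t = norm c1\<close> and \<open>s = norm x\<close>,
  which is largest at \<open>t = 0\<close>, \<open>s = 1\<close>.\<close>

lemma hankel_functional_bound:
  fixes c1 c2 c3 x y :: complex
  assumes "norm c1 \<le> 1" "norm x \<le> 1" "norm y \<le> 1 - (norm x)\<^sup>2"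
    and c2: "c2 = of_real (1 - (norm c1)\<^sup>2) * x"
    and c3: "c3 = of_real (1 - (norm c1)\<^sup>2) * (y - cnj c1 * x\<^sup>2)"
  shows "norm (c1 * c3 / 32 - c2\<^sup>2 / 16 + c1\<^sup>2 * c2 / 128 + 19 / 3072 * c1 ^ 4) \<le> 1 / 16"
proof -
  define t s where "t = norm c1" and "s = norm x"
  have t: "0 \<le> t" "t \<le> 1" and s: "0 \<le> s" "s \<le> 1" and y: "norm y \<le> 1 - s\<^sup>2"
    using assms by (auto simp: t_def s_def)
  define q where "q = 1 - t\<^sup>2"
  have q: "0 \<le> q" using t by (simp add: q_def power_le_one)
  have n2: "norm c2 = q * s"
    unfolding c2 t_def[symmetric] q_def[symmetric] norm_mult using q by (simp add: s_def)
  have "norm (y - cnj c1 * x\<^sup>2) \<le> norm y + t * s\<^sup>2"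
    by (rule order.trans[OF norm_triangle_ineq4]) (simp add: norm_mult norm_power t_def s_def)
  then have n3: "norm c3 \<le> q * (1 - s\<^sup>2 + t * s\<^sup>2)"
    unfolding c3 t_def[symmetric] q_def[symmetric] norm_mult norm_of_real abs_of_nonneg[OF q]
    using y q by (intro mult_left_mono) auto
  have "norm (c1 * c3 / 32 - c2\<^sup>2 / 16 + c1\<^sup>2 * c2 / 128 + 19 / 3072 * c1 ^ 4)
      \<le> norm (c1 * c3 / 32) + norm (c2\<^sup>2 / 16) + norm (c1\<^sup>2 * c2 / 128) + norm (19 / 3072 * c1 ^ 4)"
    by (intro norm_triangle_mono norm_triangle_ineq4 order_refl)
  also have "\<dots> = t * norm c3 / 32 + (q * s)\<^sup>2 / 16 + t\<^sup>2 * (q * s) / 128 + 19 / 3072 * t ^ 4"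
    by (simp add: norm_mult norm_divide norm_power n2 t_def)
  also have "\<dots> \<le> t * (q * (1 - s\<^sup>2 + t * s\<^sup>2)) / 32 + (q * s)\<^sup>2 / 16 + t\<^sup>2 * (q * s) / 128 + 19 / 3072 * t ^ 4"
    using mult_left_mono[OF n3 t(1)] by simp
  also have "\<dots> \<le> 1 / 16"
  proof -
    \<comment> \<open>Sorted by powers of \<open>s\<close>, the coefficient of \<open>s^2\<close> is
      nonnegative, so \<open>s = 1\<close> is the worst case. At \<open>s = 1\<close> the terms
      linear in \<open>t\<close> inside the bracket cancel, and only \<open>u = t^2\<close>
      remains.\<close>
    have "t * (q * (1 - s\<^sup>2 + t * s\<^sup>2)) / 32 + (q * s)\<^sup>2 / 16
        = t * q / 32 + q * ((1 - t) * (1 + t / 2)) * s\<^sup>2 / 16"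
      by (simp add: q_def power2_eq_square field_simps)
    also have "\<dots> \<le> t * q / 32 + q * ((1 - t) * (1 + t / 2)) / 16"
    proof -
      have "q * ((1 - t) * (1 + t / 2)) * s\<^sup>2 \<le> q * ((1 - t) * (1 + t / 2))"
        using q t s by (intro mult_left_le) (auto simp: power_le_one)
      then show ?thesis by simp
    qed
    also have "\<dots> = q * (1 - t\<^sup>2 / 2) / 16"
      by (simp add: power2_eq_square field_simps)
    finally have 1: "t * (q * (1 - s\<^sup>2 + t * s\<^sup>2)) / 32 + (q * s)\<^sup>2 / 16 \<le> q * (1 - t\<^sup>2 / 2) / 16" .
    have 2: "t\<^sup>2 * (q * s) / 128 \<le> t\<^sup>2 * q / 128"
      using s q by (simp add: mult_left_le mult_left_mono)
    define u where "u = t\<^sup>2"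
    have u: "0 \<le> u" "u \<le> 1" using t by (auto simp: u_def power_le_one)
    have "u\<^sup>2 \<le> u" using u by (simp add: power2_eq_square mult_left_le)
    \<comment> \<open>The left side minus \<open>1 / 16\<close> is
      \<open>- 11/128 * u + 91/3072 * u^2\<close>, which is at most \<open>0\<close> because
      \<open>u^2 \<le> u\<close>.\<close>
    then have "(1 - u) * (1 - u / 2) / 16 + u * (1 - u) / 128 + 19 / 3072 * u\<^sup>2 \<le> 1 / 16"
      using u by (simp add: power2_eq_square field_simps)
    moreover have "t ^ 4 = u\<^sup>2" by (simp add: u_def flip: power_mult)
    ultimately show ?thesis using 1 2 unfolding q_def u_def by linarith
  qed
  finally show ?thesis .
qed

section \<open>The Hankel determinant in terms of coefficients\<close>

lemma schlicht_has_fps_expansion: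
  assumes "f \<in> schlicht"
  shows "f has_fps_expansion fps_expansion f 0"
    "fps_expansion f 0 $ 0 = 0" "fps_expansion f 0 $ 1 = 1"
proof -
  show "f has_fps_expansion fps_expansion f 0"
    using assms by (intro has_fps_expansion_fps_expansion[OF open_ball[of 0 1]])
       (auto simp: schlicht_def)
qed (use schlicht_at_0[OF assms] in \<open>auto simp: fps_expansion_def\<close>)

text \<open>Substituting \<open>w = f z\<close> into the definition of the logarithm turns the
  inverse function into \<open>z\<close>, so the inverse series never has to be expanded. The factor
  4 absorbs the two halves in \<open>log_inverse_coeff\<close>.\<close>

lemma hankel_log_inverse_eq:
  assumes "f \<in> schlicht"
  defines "a \<equiv> fps_nth (fps_expansion f 0)"
  shows "4 * hankel_log_inverse f = a 2 * a 4 - (a 3)\<^sup>2 - (a 2)\<^sup>2 * a 3 + 13 / 12 * a 2 ^ 4"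
proof -
  define \<phi> where "\<phi> = fps_expansion f 0"
  note \<phi> = schlicht_has_fps_expansion[OF assms(1), folded \<phi>_def]
  have inj: "inj_on f (ball 0 1)" using assms(1) by (simp add: schlicht_def)
  obtain r where r: "r > 0" and L: "log_inverse f holomorphic_on ball 0 r"
    and eq: "\<And>w. w \<in> ball 0 r \<Longrightarrow> w \<noteq> 0 \<Longrightarrow> exp (log_inverse f w) = inverse_fun f w / w"
    using log_inverse_expansion[OF assms(1)] by blast
  define \<Lambda> where "\<Lambda> = fps_expansion (log_inverse f) 0"
  have \<Lambda>: "log_inverse f has_fps_expansion \<Lambda>"
    unfolding \<Lambda>_def using r by (intro has_fps_expansion_fps_expansion[OF open_ball _ L]) auto
  have \<Lambda>0: "\<Lambda> $ 0 = 0" by (simp add: \<Lambda>_def fps_expansion_def log_inverse_def)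
  define E where "E = \<Lambda> oo \<phi>"
  define X where "X = fps_exp 1 oo E"
  have E0: "E $ 0 = 0" by (simp add: E_def \<Lambda>0)
  have lhs: "(\<lambda>z. (exp \<circ> (log_inverse f \<circ> f)) z * f z) has_fps_expansion (X * \<phi>)"
    unfolding X_def E_def
    by (intro has_fps_expansion_mult has_fps_expansion_compose has_fps_expansion_exp1 \<Lambda> \<phi>)
       (simp add: \<Lambda>0)
  have "isCont f 0" using \<phi>(1) by (rule has_fps_expansion_imp_continuous)
  then have "(f \<longlongrightarrow> f 0) (nhds 0)"
    by (simp only: continuous_at tendsto_at_iff_tendsto_nhds)
  then have "(f \<longlongrightarrow> 0) (nhds 0)" by (simp only: schlicht_at_0(1)[OF assms(1)])
  then have "eventually (\<lambda>z. f z \<in> ball 0 r) (nhds 0)"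
    using r by (intro topological_tendstoD) auto
  moreover have "eventually (\<lambda>z. z \<in> ball (0::complex) 1) (nhds 0)"
    by (rule eventually_nhds_in_open) auto
  \<comment> \<open>Multiplying by \<open>f z\<close> instead of dividing makes the identity hold at
    \<open>0\<close> too; by injectivity this is the only zero of \<open>f\<close>.\<close>
  ultimately have "eventually (\<lambda>z. (exp \<circ> (log_inverse f \<circ> f)) z * f z = z) (nhds 0)"
  proof eventually_elim
    case (elim z)
    have inv: "inverse_fun f (f z) = z"
      using inv_into_f_f[OF inj elim(2)] by (simp add: inverse_fun_def)
    show ?case
    proof (cases "f z = 0")
      case True
      then have "z = 0"
        using inj_onD[OF inj _ elim(2), of 0] schlicht_at_0(1)[OF assms(1)] by simp
      then show ?thesis using True by simp
    next
      case False
      then show ?thesis using eq[OF elim(1) False] inv by simp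
    qed
  qed
  then have X: "X * \<phi> = fps_X"
    by (rule fps_eq_if_eventually_eq[OF _ lhs has_fps_expansion_fps_X])
  \<comment> \<open>Differentiating \<open>exp (L (f z)) * f z = z\<close>, where \<open>L\<close> is \<open>log_inverse f\<close>,
    and multiplying by \<open>f\<close> eliminates the exponential.\<close>
  have "fps_deriv X = X * fps_deriv E"
    unfolding X_def using fps_compose_deriv[OF E0] by simp
  then have "1 = X * (fps_deriv E * \<phi> + fps_deriv \<phi>)"
    using arg_cong[OF X, of fps_deriv] by (simp add: algebra_simps)
  then have "\<phi> = (X * \<phi>) * (fps_deriv E * \<phi> + fps_deriv \<phi>)"
    by (metis mult.assoc mult.commute mult_1)
  then have key: "\<phi> = fps_X * (fps_deriv E * \<phi> + fps_deriv \<phi>)"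
    by (simp only: X)
  have a: "a n = \<phi> $ n" for n by (simp add: a_def \<phi>_def)
  have a01: "\<phi> $ 0 = 0" "\<phi> $ Suc 0 = 1" using \<phi> by auto
  \<comment> \<open>These equations determine \<open>E $ 1\<close>, \<open>E $ 2\<close>,
    \<open>E $ 3\<close> in turn. Combined with \<open>E = \<Lambda> oo \<phi>\<close> they form a
    triangular system for the coefficients of \<open>\<Lambda>\<close>.\<close>
  have k2: "a 2 = E $ 1 + 2 * a 2"
    using arg_cong[OF key, of "\<lambda>F. F $ 2"]
    by (simp add: a a01 fps_mult_nth eval_nat_numeral)
  have k3: "a 3 = E $ 1 * a 2 + 2 * E $ 2 + 3 * a 3"
    using arg_cong[OF key, of "\<lambda>F. F $ 3"]
    by (simp add: a a01 fps_mult_nth eval_nat_numeral)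
  have k4: "a 4 = E $ 1 * a 3 + 2 * E $ 2 * a 2 + 3 * E $ 3 + 4 * a 4"
    using arg_cong[OF key, of "\<lambda>F. F $ 4"]
    by (simp add: a a01 fps_mult_nth eval_nat_numeral)
  have E1: "E $ 1 = \<Lambda> $ 1"
    by (simp add: E_def fps_compose_nth a01)
  have E2: "E $ 2 = \<Lambda> $ 1 * a 2 + \<Lambda> $ 2"
    by (simp add: E_def fps_compose_nth a a01 eval_nat_numeral fps_mult_nth)
  have E3: "E $ 3 = \<Lambda> $ 1 * a 3 + 2 * \<Lambda> $ 2 * a 2 + \<Lambda> $ 3"
    by (simp add: E_def fps_compose_nth a a01 eval_nat_numeral fps_mult_nth)
  have l1: "\<Lambda> $ 1 = - a 2"
    using k2 E1 by (simp add: algebra_simps eq_neg_iff_add_eq_0)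
  have "2 * \<Lambda> $ 2 = - (2 * a 3 - 3 * (a 2)\<^sup>2)"
    using k3 unfolding E1 E2 l1 by (simp add: power2_eq_square, algebra)
  then have l2: "\<Lambda> $ 2 = - a 3 + 3 / 2 * (a 2)\<^sup>2" by (simp add: field_simps)
  have "3 * \<Lambda> $ 3 = - 3 * a 4 + 12 * a 2 * a 3 - 10 * a 2 ^ 3"
    using k4 unfolding E1 E2 E3 l1 l2
    by (simp add: power2_eq_square power3_eq_cube field_simps, algebra)
  then have l3: "\<Lambda> $ 3 = - a 4 + 4 * a 2 * a 3 - 10 / 3 * a 2 ^ 3" by (simp add: field_simps)
  have "4 * hankel_log_inverse f = \<Lambda> $ 1 * \<Lambda> $ 3 - (\<Lambda> $ 2)\<^sup>2"
    by (simp add: hankel_log_inverse_def log_inverse_coeff_def \<Lambda>_def power2_eq_square)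
  also have "\<dots> = a 2 * a 4 - (a 3)\<^sup>2 - (a 2)\<^sup>2 * a 3 + 13 / 12 * a 2 ^ 4"
    unfolding l1 l2 l3 by (simp add: field_simps eval_nat_numeral)
  finally show ?thesis .
qed

text \<open>Squaring removes the root, and clearing the denominator removes the quotient. The two
  resulting series identities express \<open>a2\<close>, \<open>a3\<close>, \<open>a4\<close>
  through the coefficients of \<open>W\<close>. This serves both the upper bound and the extremal
  function.\<close>

lemma hankel_of_schwarz:
  assumes f: "f \<in> schlicht" and w: "w has_fps_expansion W" and W0: "W $ 0 = 0"
    and hol: "sym_quotient f holomorphic_on ball 0 1"
    and sub: "\<And>z. z \<in> ball 0 1 \<Longrightarrow> sym_quotient f z = csqrt (1 + w z)"
  shows "4 * hankel_log_inverse f =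
    W $ 1 * W $ 3 / 32 - (W $ 2)\<^sup>2 / 16 + (W $ 1)\<^sup>2 * W $ 2 / 128 + 19 / 3072 * (W $ 1) ^ 4"
proof -
  define \<phi> where "\<phi> = fps_expansion f 0"
  note \<phi> = schlicht_has_fps_expansion[OF f, folded \<phi>_def]
  have inj: "inj_on f (ball 0 1)" using f by (simp add: schlicht_def)
  define P where "P = fps_expansion (sym_quotient f) 0"
  have P: "sym_quotient f has_fps_expansion P"
    unfolding P_def by (intro has_fps_expansion_fps_expansion[OF open_ball _ hol]) simp
  \<comment> \<open>The equation \<open>P ^ 2 = 1 + W\<close> fixes \<open>P\<close> only up to
    sign; the value \<open>1\<close> that \<open>sym_quotient\<close> takes at the origin selects
    the sign.\<close>
  have P0: "P $ 0 = 1" by (simp add: P_def fps_expansion_def sym_quotient_def)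
  have ball: "eventually (\<lambda>z. z \<in> ball (0::complex) 1) (nhds 0)"
    by (rule eventually_nhds_in_open) auto
  then have "eventually (\<lambda>z. (sym_quotient f z)^2 = 1 + w z) (nhds 0)"
    by eventually_elim (use sub in auto)
  moreover have "(\<lambda>z. (sym_quotient f z)^2) has_fps_expansion P ^ 2"
    by (intro fps_expansion_intros P)
  moreover have "(\<lambda>z. 1 + w z) has_fps_expansion 1 + W" by (intro fps_expansion_intros w)
  ultimately have PW: "P ^ 2 = 1 + W"
    by (rule fps_eq_if_eventually_eq)
  define N where "N = \<phi> - (\<phi> oo (- fps_X))"
  have "(\<lambda>z. f z - (f \<circ> (\<lambda>z. - z)) z) has_fps_expansion N"
    unfolding N_def by (intro fps_expansion_intros \<phi>) simp
  then have NP: "(\<lambda>z. (f z - (f \<circ> (\<lambda>z. - z)) z) * sym_quotient f z) has_fps_expansion N * P"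
    by (intro fps_expansion_intros P)
  have dF: "(\<lambda>z. 2 * z * deriv f z) has_fps_expansion 2 * fps_X * fps_deriv \<phi>"
    by (intro fps_expansion_intros \<phi>)
  \<comment> \<open>Both sides vanish at \<open>0\<close>; elsewhere injectivity keeps the
    denominator away from zero.\<close>
  from ball have "eventually (\<lambda>z. (f z - (f \<circ> (\<lambda>z. - z)) z) * sym_quotient f z
      = 2 * z * deriv f z) (nhds 0)"
  proof eventually_elim
    case (elim z)
    show ?case
    proof (cases "z = 0")
      case False
      then have "f z \<noteq> f (- z)" using inj_onD[OF inj, of z "- z"] elim by auto
      then show ?thesis using False by (simp add: sym_quotient_def)
    qed simp
  qed
  then have key: "N * P = 2 * fps_X * fps_deriv \<phi>"
    by (rule fps_eq_if_eventually_eq[OF _ NP dF])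
  \<comment> \<open>Even coefficients cancel and odd ones double, so up to degree 4 only
    \<open>N $ 1 = 2\<close> and \<open>N $ 3 = 2 * \<phi> $ 3\<close> contribute.\<close>
  have N: "N $ n = \<phi> $ n - (-1) ^ n * \<phi> $ n" for n
    unfolding N_def by (simp add: fps_compose_uminus')
  have a01: "\<phi> $ 0 = 0" "\<phi> $ Suc 0 = 1" using \<phi> by auto
  have p1: "2 * P $ 1 = W $ 1"
    using arg_cong[OF PW, of "\<lambda>F. F $ 1"] P0
    by (simp add: power2_eq_square fps_mult_nth)
  have p2: "2 * P $ 2 + (P $ 1)\<^sup>2 = W $ 2"
    using arg_cong[OF PW, of "\<lambda>F. F $ 2"] P0
    by (simp add: power2_eq_square fps_mult_nth eval_nat_numeral)
  have p3: "2 * P $ 3 + 2 * (P $ 1 * P $ 2) = W $ 3"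
    using arg_cong[OF PW, of "\<lambda>F. F $ 3"] P0
    by (simp add: power2_eq_square fps_mult_nth eval_nat_numeral)
  have k: "(N * P) $ n = 2 * of_nat n * \<phi> $ n" for n
    unfolding key by (cases n) (simp_all add: mult.assoc numeral_fps_const)
  have k2: "2 * P $ 1 = 4 * \<phi> $ 2"
    using k[of 2] by (simp add: fps_mult_nth eval_nat_numeral N a01 P0)
  have k3: "2 * P $ 2 + 2 * \<phi> $ 3 = 6 * \<phi> $ 3"
    using k[of 3] by (simp add: fps_mult_nth eval_nat_numeral N a01 P0)
  have k4: "2 * P $ 3 + 2 * \<phi> $ 3 * P $ 1 = 8 * \<phi> $ 4"
    using k[of 4] by (simp add: fps_mult_nth eval_nat_numeral N a01 P0)
  have q1: "P $ 1 = W $ 1 / 2" using p1 by (simp add: field_simps)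
  have q2: "P $ 2 = W $ 2 / 2 - (W $ 1)\<^sup>2 / 8"
    using p2 unfolding q1 by (simp add: power2_eq_square field_simps)
  have q3: "P $ 3 = W $ 3 / 2 - W $ 1 * W $ 2 / 4 + (W $ 1) ^ 3 / 16"
  proof -
    have "P $ 3 = (W $ 3 - 2 * (P $ 1 * P $ 2)) / 2" unfolding p3[symmetric] by simp
    also have "\<dots> = W $ 3 / 2 - W $ 1 * W $ 2 / 4 + (W $ 1) ^ 3 / 16"
      unfolding q1 q2 by (simp add: power2_eq_square power3_eq_cube field_simps)
    finally show ?thesis .
  qed
  have a2: "\<phi> $ 2 = W $ 1 / 4"
    using k2 q1 by (simp add: field_simps)
  have a3: "\<phi> $ 3 = W $ 2 / 4 - (W $ 1)\<^sup>2 / 16"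
  proof -
    have "\<phi> $ 3 = P $ 2 / 2" using k3 by simp
    also have "\<dots> = W $ 2 / 4 - (W $ 1)\<^sup>2 / 16" unfolding q2 by (simp add: diff_divide_distrib)
    finally show ?thesis .
  qed
  have "8 * \<phi> $ 4 = 2 * P $ 3 + 2 * \<phi> $ 3 * P $ 1" using k4 by simp
  also have "\<dots> = W $ 3 - W $ 1 * W $ 2 / 4 + (W $ 1) ^ 3 / 16"
    unfolding q1 q3 a3 by (simp add: power2_eq_square power3_eq_cube field_simps)
  finally have "\<phi> $ 4 = (W $ 3 - W $ 1 * W $ 2 / 4 + (W $ 1) ^ 3 / 16) / 8"
    by (simp add: mult.commute)
  then have a4: "\<phi> $ 4 = W $ 3 / 8 - W $ 1 * W $ 2 / 32 + (W $ 1) ^ 3 / 128"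
    by (simp add: add_divide_distrib diff_divide_distrib)
  show ?thesis
    unfolding hankel_log_inverse_eq[OF f, folded \<phi>_def] a2 a3 a4
    by (simp add: field_simps eval_nat_numeral)
qed

section \<open>The extremal function and its univalence\<close>

text \<open>The Noshiro-Warschawski criterion. If \<open>f z = f w\<close> with
  \<open>z \<noteq> w\<close>, the mean value theorem for the real part of
  \<open>f / (z - w)\<close> on the segment yields a point where the real part of \<open>f'\<close>
  is zero.\<close>

lemma Re_deriv_pos_imp_inj_on:
  assumes "convex S"
    and d: "\<And>z. z \<in> S \<Longrightarrow> (f has_field_derivative f' z) (at z)"
    and pos: "\<And>z. z \<in> S \<Longrightarrow> Re (f' z) > 0"
  shows "inj_on f S"
proof (rule inj_onI, rule ccontr)
  fix z w assume zw: "z \<in> S" "w \<in> S" "f z = f w" "z \<noteq> w"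
  have seg: "closed_segment w z \<subseteq> S" using assms(1) zw closed_segment_subset by blast
  have "\<exists>u. u \<in> closed_segment w z \<and>
      Re (f z / (z - w)) - Re (f w / (z - w)) = Re (f' u / (z - w) * (z - w))"
    by (rule complex_mvt_line) (use d seg in \<open>blast intro: DERIV_cdivide\<close>)
  then show False using pos seg zw by force
qed

lemma schlichtI:
  assumes hol: "f holomorphic_on ball 0 1" and "inj_on f (ball 0 1)"
    and f0: "f 0 = 0" and f1: "deriv f 0 = 1"
  shows "f \<in> schlicht"
proof -
  have "(\<lambda>n. (deriv ^^ (n + 2)) f 0 / fact (n + 2) * z ^ (n + 2)) sums (f z - z)"
    if z: "z \<in> ball 0 1" for z
  proof -
    have "(\<lambda>n. (deriv ^^ n) f 0 / fact n * (z - 0) ^ n) sums f z"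
      by (rule holomorphic_power_series[OF hol z])
    then have "(\<lambda>n. (deriv ^^ (n + 2)) f 0 / fact (n + 2) * z ^ (n + 2)) sums
        (f z - (\<Sum>n<2. (deriv ^^ n) f 0 / fact n * z ^ n))"
      by (subst sums_iff_shift) simp
    then show ?thesis by (simp add: eval_nat_numeral f0 f1)
  qed
  then show ?thesis unfolding schlicht_def using assms(1,2)
    by (auto intro!: exI[of _ "\<lambda>n. (deriv ^^ n) f 0 / fact n"])
qed

text \<open>Up to the factor \<open>2 / exp 1\<close> this is the derivative of
  \<open>extremal\<close> at a point with root \<open>s\<close>. Multiplying by
  \<open>cnj (1 + s)\<close> reduces the claim to \<open>X * cos y > y * sin y\<close>, which holds
  since the half lemniscate lies in \<open>|y| < x\<close> and \<open>|y| < 1/2\<close>.\<close>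

lemma Re_lemniscate_pos:
  assumes s: "Re s > 0" and lem: "norm (s\<^sup>2 - 1) < 1"
  shows "Re (s * exp s / (1 + s)) > 0"
proof -
  define x y where "x = Re s" and "y = Im s"
  have "(norm (s\<^sup>2 - 1))\<^sup>2 < 1" using lem by (simp add: power_less_one_iff abs_square_less_1)
  then have A: "(x\<^sup>2 - y\<^sup>2 - 1)\<^sup>2 + (2 * x * y)\<^sup>2 < 1"
    by (simp add: cmod_power2 x_def y_def Re_power2 Im_power2)
  have sum: "(x\<^sup>2 + y\<^sup>2)\<^sup>2 < 2 * (x\<^sup>2 - y\<^sup>2)"
    using A by (simp add: power2_eq_square algebra_simps)
  have "y\<^sup>2 < x\<^sup>2" using le_less_trans[OF zero_le_power2 sum] by simp
  then have xy: "\<bar>y\<bar> < x" using s abs_le_square_iff[of x y] by (simp add: x_def not_le[symmetric])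
  \<comment> \<open>Completing the square in the lemniscate inequality isolates
    \<open>4 * y^2\<close> and bounds the height of the lemniscate.\<close>
  have "(x\<^sup>2 + y\<^sup>2 - 1)\<^sup>2 + 4 * y\<^sup>2 - 1 < 0"
    using sum by (simp add: power2_eq_square algebra_simps)
  then have "(2 * y)\<^sup>2 < 1\<^sup>2"
  proof -
    have "a + 4 * b - 1 < 0 \<Longrightarrow> 0 \<le> a \<Longrightarrow> 4 * b < 1" for a b :: real by linarith
    from this[OF \<open>_ < 0\<close> zero_le_power2] show ?thesis by (simp only: power_mult_distrib) simp
  qed
  then have y: "\<bar>y\<bar> < 1 / 2" by (simp only: abs_square_less_1 power_one abs_mult)
  \<comment> \<open>\<open>X\<close> and \<open>y\<close> are the real and imaginary parts of
    \<open>s * cnj (1 + s)\<close>.\<close>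
  define X where "X = x + x\<^sup>2 + y\<^sup>2"
  have X: "\<bar>y\<bar> < X" using xy zero_le_power2[of x] zero_le_power2[of y] unfolding X_def by linarith
  have y2: "y\<^sup>2 \<le> \<bar>y\<bar> / 2"
    using y mult_left_mono[of "\<bar>y\<bar>" "1/2" "\<bar>y\<bar>"] by (simp add: power2_eq_square flip: abs_mult)
  have cos: "1 - y\<^sup>2 / 2 \<le> cos y"
  proof -
    have "(sin (y / 2))\<^sup>2 \<le> (y / 2)\<^sup>2"
      using abs_sin_x_le_abs_x[of "y / 2"] by (simp only: abs_le_square_iff)
    then show ?thesis using cos_double_sin[of "y / 2"] by (simp add: power_divide)
  qed
  have "y * sin y \<le> y\<^sup>2"
  proof -
    have "y * sin y \<le> \<bar>y\<bar> * \<bar>sin y\<bar>" by (metis abs_ge_self abs_mult)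
    also have "\<dots> \<le> \<bar>y\<bar> * \<bar>y\<bar>" by (intro mult_left_mono abs_sin_x_le_abs_x) auto
    finally show ?thesis by (simp add: power2_eq_square)
  qed
  also have "\<dots> \<le> \<bar>y\<bar> * (3 / 4)" using y2 by simp
  also have "\<dots> \<le> \<bar>y\<bar> * cos y" using cos y2 y by (intro mult_left_mono) auto
  also have "\<dots> < X * cos y" using cos y2 y X by (intro mult_strict_right_mono) auto
  finally have pos: "X * cos y - y * sin y > 0" by simp
  have "1 + s \<noteq> 0" using s by (auto simp: complex_eq_iff)
  then have n: "(norm (1 + s))\<^sup>2 > 0" by simp
  have "s * exp s / (1 + s) = s * cnj (1 + s) * exp s / of_real ((norm (1 + s))\<^sup>2)"
    by (subst complex_div_cnj) (simp add: algebra_simps)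
  then have "Re (s * exp s / (1 + s)) = Re (s * cnj (1 + s) * exp s) / (norm (1 + s))\<^sup>2"
    by (simp only: Re_divide_of_real)
  also have "Re (s * cnj (1 + s) * exp s) = exp x * (X * cos y - y * sin y)"
    by (simp add: X_def x_def y_def Re_exp Im_exp algebra_simps power2_eq_square)
  finally show ?thesis using pos n by simp
qed

text \<open>The constants \<open>2\<close> and \<open>- 1\<close> normalise the derivative at
  \<open>0\<close>, where the root equals \<open>1\<close>.\<close>

definition extremal :: "complex \<Rightarrow> complex" where
  "extremal z = 2 * z * exp (csqrt (1 + z\<^sup>2) - 1) / (1 + csqrt (1 + z\<^sup>2))"

lemma one_plus_square_notin_nonpos_Reals:
  assumes "norm (z :: complex) < 1" shows "1 + z\<^sup>2 \<notin> \<real>\<^sub>\<le>\<^sub>0"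
proof -
  have "norm (z\<^sup>2) < 1" using assms by (simp add: norm_power power_less_one_iff)
  then have "Re (1 + z\<^sup>2) > 0" using abs_Re_le_cmod[of "z\<^sup>2"] by simp
  then show ?thesis by (simp add: complex_nonpos_Reals_iff)
qed

text \<open>The principal root has nonnegative real part, and a purely imaginary value would make
  the radicand a nonpositive real.\<close>

lemma Re_csqrt_one_plus_square:
  assumes "norm z < 1" shows "Re (csqrt (1 + z\<^sup>2)) > 0"
proof (rule ccontr)
  assume "\<not> ?thesis"
  then have "Re (csqrt (1 + z\<^sup>2)) = 0" using Re_csqrt[of "1 + z\<^sup>2"] by simp
  then have "(csqrt (1 + z\<^sup>2))\<^sup>2 \<in> \<real>\<^sub>\<le>\<^sub>0"
    by (simp only: complex_nonpos_Reals_iff Re_power2 Im_power2) simp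
  then show False using one_plus_square_notin_nonpos_Reals[OF assms] by simp
qed

lemma has_field_derivative_extremal:
  assumes z: "norm z < 1"
  defines "s \<equiv> csqrt (1 + z\<^sup>2)"
  shows "(extremal has_field_derivative 2 * s * exp (s - 1) / (1 + s)) (at z)"
proof -
  have s2: "s\<^sup>2 = 1 + z\<^sup>2" by (simp add: s_def)
  have Re: "Re s > 0" unfolding s_def by (rule Re_csqrt_one_plus_square[OF z])
  then have nz: "s \<noteq> 0" "1 + s \<noteq> 0" by (auto simp: complex_eq_iff)
  have s': "((\<lambda>z. csqrt (1 + z\<^sup>2)) has_field_derivative z / s) (at z)"
    unfolding s_def
    by (rule derivative_eq_intros refl one_plus_square_notin_nonpos_Reals[OF z])+ simp
  define e where "e = exp (s - 1)"
  have e': "((\<lambda>z. exp (csqrt (1 + z\<^sup>2) - 1)) has_field_derivative e * (z / s)) (at z)"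
    using DERIV_chain2[OF DERIV_exp DERIV_diff[OF s' DERIV_const[of 1]]] by (simp add: e_def s_def)
  have "(extremal has_field_derivative
      ((2 * e + e * (z / s) * (2 * z)) * (1 + s) - 2 * z * e * (z / s)) / ((1 + s) * (1 + s))) (at z)"
    using DERIV_divide[OF DERIV_mult[OF DERIV_cmult_Id[of 2] e'] DERIV_add[OF DERIV_const[of 1] s']] nz
    by (simp add: extremal_def[abs_def] e_def s_def)
  \<comment> \<open>The numerator is grouped so that \<open>z\<close> occurs only in
    \<open>z * (z / s)\<close>. Since \<open>s^2 = 1 + z^2\<close>, this equals
    \<open>s - 1 / s\<close>, and a factor \<open>1 + s\<close> then splits off.\<close>
  also have "(2 * e + e * (z / s) * (2 * z)) * (1 + s) - 2 * z * e * (z / s)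
      = 2 * e * (1 + z * (z / s)) * (1 + s) - 2 * e * (z * (z / s))"
    by (simp add: algebra_simps)
  also have "z * (z / s) = s - 1 / s"
    using s2 nz by (simp add: field_simps power2_eq_square)
  also have "2 * e * (1 + (s - 1 / s)) * (1 + s) - 2 * e * (s - 1 / s) = 2 * s * e * (1 + s)"
    using nz by (simp add: field_simps)
  also have "2 * s * e * (1 + s) / ((1 + s) * (1 + s)) = 2 * s * e / (1 + s)"
    using nz by simp
  finally show ?thesis unfolding e_def .
qed

lemma extremal_schlicht: "extremal \<in> schlicht"
proof (rule schlichtI)
  show "extremal holomorphic_on ball 0 1"
    using has_field_derivative_extremal by (force simp: holomorphic_on_open)
  show "inj_on extremal (ball 0 1)"
  proof (rule Re_deriv_pos_imp_inj_on[OF convex_ball has_field_derivative_extremal])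
    fix z :: complex assume "z \<in> ball 0 1"
    then have z: "norm z < 1" by simp
    define s where "s = csqrt (1 + z\<^sup>2)"
    have "norm (s\<^sup>2 - 1) < 1" using z by (simp add: s_def norm_power power_less_one_iff)
    then have "Re (s * exp s / (1 + s)) > 0"
      using Re_lemniscate_pos Re_csqrt_one_plus_square[OF z] by (simp add: s_def)
    moreover have "2 * s * exp (s - 1) / (1 + s) = of_real (2 / exp 1) * (s * exp s / (1 + s))"
      by (simp add: exp_diff exp_of_real[symmetric])
    ultimately have "Re (2 * s * exp (s - 1) / (1 + s)) > 0"
      by (simp only: times_complex.sel Re_complex_of_real Im_complex_of_real) simp
    then show "Re (2 * csqrt (1 + z\<^sup>2) * exp (csqrt (1 + z\<^sup>2) - 1) / (1 + csqrt (1 + z\<^sup>2))) > 0"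
      by (simp only: s_def)
  qed simp
  show "extremal 0 = 0" by (simp add: extremal_def)
  show "deriv extremal 0 = 1"
    using DERIV_imp_deriv[OF has_field_derivative_extremal[of 0]] by simp
qed

lemma sym_quotient_extremal:
  assumes "z \<in> ball 0 1"
  shows "sym_quotient extremal z = csqrt (1 + z\<^sup>2)"
proof (cases "z = 0")
  case False
  define s where "s = csqrt (1 + z\<^sup>2)"
  have z: "norm z < 1" using assms by simp
  have "1 + s \<noteq> 0" using Re_csqrt_one_plus_square[OF z] by (auto simp: s_def complex_eq_iff)
  moreover have "deriv extremal z = 2 * s * exp (s - 1) / (1 + s)"
    unfolding s_def by (rule DERIV_imp_deriv[OF has_field_derivative_extremal[OF z]])
  moreover have "extremal z - extremal (- z) = 4 * z * exp (s - 1) / (1 + s)"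
    by (simp add: extremal_def s_def[symmetric])
  ultimately show ?thesis using False
    by (simp add: sym_quotient_def s_def[symmetric])
qed (simp add: sym_quotient_def)

section \<open>The sharp bound on the class\<close>

theorem theorem2p10:
  shows "(\<forall>f\<in>S_SL. cmod (hankel_log_inverse f) \<le> 1 / 64) \<and>
         (\<exists>f\<in>S_SL. cmod (hankel_log_inverse f) = 1 / 64)"
proof (intro conjI ballI bexI)
  fix f assume "f \<in> S_SL"
  then have f: "f \<in> schlicht" and hol: "sym_quotient f holomorphic_on ball 0 1"
    and "\<exists>w. w holomorphic_on ball 0 1 \<and> w ` ball 0 1 \<subseteq> ball 0 1 \<and> w 0 = 0 \<and>
          (\<forall>z\<in>ball 0 1. sym_quotient f z = csqrt (1 + w z))"
    unfolding S_SL_def subordinate_def by auto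
  then obtain w where w: "w holomorphic_on ball 0 1" "w ` ball 0 1 \<subseteq> ball 0 1" "w 0 = 0"
    and sub: "\<And>z. z \<in> ball 0 1 \<Longrightarrow> sym_quotient f z = csqrt (1 + w z)"
    by blast
  define W where "W = fps_expansion w 0"
  have W: "w has_fps_expansion W"
    unfolding W_def by (rule has_fps_expansion_fps_expansion[OF open_ball _ w(1)]) simp
  have W0: "W $ 0 = 0" by (simp add: W_def fps_expansion_def w(3))
  have bound: "norm (w z) \<le> 1" if "norm z < 1" for z
    using w(2) that by (auto simp: image_subset_iff intro: less_imp_le)
  obtain h H where h: "h holomorphic_on ball 0 1"
      "\<And>z. norm z < 1 \<Longrightarrow> norm (h z) \<le> 1" "h has_fps_expansion H"
      "W - fps_const (W $ 0) = fps_X * H * (1 - fps_const (cnj (W $ 0)) * W)"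
    using schur_step_fps[OF w(1) bound W] by blast
  \<comment> \<open>As \<open>W $ 0 = 0\<close>, the Schur step reads \<open>W = fps_X * H\<close>,
    which shifts indices by one.\<close>
  have WH: "W $ 1 = H $ 0" "W $ 2 = H $ 1" "W $ 3 = H $ 2"
    using h(4) by (simp_all add: W0)
  obtain x y where xy: "norm (H $ 0) \<le> 1" "norm x \<le> 1" "norm y \<le> 1 - (norm x)\<^sup>2"
    "H $ 1 = of_real (1 - (norm (H $ 0))\<^sup>2) * x"
    "H $ 2 = of_real (1 - (norm (H $ 0))\<^sup>2) * (y - cnj (H $ 0) * x\<^sup>2)"
    using bounded_fps_coeffs[OF h(1-3)] by blast
  have "norm (4 * hankel_log_inverse f) \<le> 1 / 16"
    by (subst hankel_of_schwarz[OF f W W0 hol])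
       (simp_all only: sub WH hankel_functional_bound[OF xy])
  then show "cmod (hankel_log_inverse f) \<le> 1 / 64" by (simp add: norm_mult)
next
  have hol: "(\<lambda>z. csqrt (1 + z\<^sup>2)) holomorphic_on ball 0 1"
    by (intro holomorphic_intros) (simp add: one_plus_square_notin_nonpos_Reals)
  have sq_hol: "sym_quotient extremal holomorphic_on ball 0 1"
    using hol by (simp only: holomorphic_cong[OF refl sym_quotient_extremal])
  have csqrt_hol: "(\<lambda>z. csqrt (1 + z)) holomorphic_on ball 0 1"
  proof (intro holomorphic_intros)
    fix z :: complex assume "z \<in> ball 0 1"
    then have "Re (1 + z) > 0" using abs_Re_le_cmod[of z] by simp
    then show "1 + z \<notin> \<real>\<^sub>\<le>\<^sub>0" by (simp add: complex_nonpos_Reals_iff)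
  qed
  have "sym_quotient extremal \<prec>\<^sub>s (\<lambda>z. csqrt (1 + z))"
    unfolding subordinate_def
    by (intro conjI sq_hol csqrt_hol exI[of _ "\<lambda>z. z\<^sup>2"])
       (auto simp: sym_quotient_extremal norm_power power_less_one_iff intro!: holomorphic_intros)
  then show "extremal \<in> S_SL" using extremal_schlicht by (simp add: S_SL_def)
  \<comment> \<open>For \<open>w z = z^2\<close> only \<open>W $ 2 = 1\<close> is nonzero, so only
    the term \<open>- (W $ 2)^2 / 16\<close> survives.\<close>
  have "4 * hankel_log_inverse extremal = - 1 / 16"
    by (subst hankel_of_schwarz[OF extremal_schlicht has_fps_expansion_fps_X_power[of 2] _ sq_hol])
       (simp_all add: sym_quotient_extremal fps_X_power_nth)
  then have "norm (4 * hankel_log_inverse extremal) = 1 / 16" by simp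
  then show "cmod (hankel_log_inverse extremal) = 1 / 64" by (simp add: norm_mult)
qed

end
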